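(* Let $I\subseteq R=\Bbbk[x_0,\ldots,x_n]$ be a monomial ideal. For every positive integer $m$, the $m$-th symbolic power of $I$ is $$I^{(m)}=\bigcap_{P\in\operatorname{maxAss}(I)} Q_{\subseteq P}^{\,m},\qquad\text{where } Q_{\subseteq P}=R\cap I R_P .$$
   Context: $\Bbbk$ is a field. $\operatorname{Ass}(I)$ is the set of associated primes of $I$ (of $R/I$), and $\operatorname{maxAss}(I)\subseteq\operatorname{Ass}(I)$ is the subset of associated primes maximal with respect to inclusion. The $m$-th symbolic power of $I$ is $I^{(m)} = R\cap\bigcap_{P\in \operatorname{Ass}(I)} I^m R_P$ (inside the fraction field of $R$). $Q_{\subseteq P}^{\,m}$ denotes the ordinary $m$-th power of the ideal $Q_{\subseteq P}$. An empty intersection of ideals of $R$ is read as $R$. *)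

theory Defs
  imports
    "HOL-Library.Poly_Mapping"
    "HOL-Computational_Algebra.Fraction_Field"
    "HOL-Algebra.Ideal_Product"
    "HOL-Algebra.Algebraic_Closure_Type"
begin

text \<open>
  A polynomial is a finitely supported map from exponent vectors to coefficients. With
  a finite type of variables \<open>'v\<close> having \<open>n + 1\<close> elements this is
  \<open>k[x\<^sub>0, \<dots>, x\<^sub>n]\<close>. The linear order on \<open>'v\<close> (the order of the
  indices) serves only to obtain the library's \<open>idom\<close> instance, which the type
  of fractions requires.
\<close>

type_synonym ('v, 'k) mpoly = "('v \<Rightarrow>\<^sub>0 nat) \<Rightarrow>\<^sub>0 'k"

abbreviation type_ring :: "'a::comm_ring_1 ring"
  where "type_ring \<equiv> ring_of_type_algebra"

definition monomial_ideal :: "('v, 'k::field) mpoly set \<Rightarrow> bool"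
  where "monomial_ideal I \<longleftrightarrow>
    (\<exists>E. I = genideal type_ring ((\<lambda>e. Poly_Mapping.single e 1) ` E))"

text \<open>
  The colon ideal \<open>(I : f)\<close> is the annihilator of the class of \<open>f\<close> in \<open>R/I\<close>.
\<close>

definition Ass :: "'a::comm_ring_1 set \<Rightarrow> 'a set set"
  where "Ass I = {P. primeideal P type_ring \<and> (\<exists>f. P = {r. r * f \<in> I})}"

definition maxAss :: "'a::comm_ring_1 set \<Rightarrow> 'a set set"
  where "maxAss I = {P \<in> Ass I. \<forall>P' \<in> Ass I. P \<subseteq> P' \<longrightarrow> P' = P}"

definition ideal_power :: "'a::comm_ring_1 set \<Rightarrow> nat \<Rightarrow> 'a set"
  where "ideal_power I m = I [^]\<^bsub>ideals_set type_ring\<^esub> m"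

text \<open>
  The localization \<open>R\<^sub>P\<close>, as a subring of the fraction field. Denominators outside a
  prime ideal are nonzero.
\<close>

definition localization :: "'a::idom set \<Rightarrow> 'a fract ring"
  where "localization P =
    type_ring \<lparr>carrier := {Fraction_Field.Fract a s | a s. s \<notin> P}\<rparr>"

definition extension :: "'a::idom set \<Rightarrow> 'a set \<Rightarrow> 'a fract set"
  where "extension P J = genideal (localization P) ((\<lambda>r. Fraction_Field.Fract r 1) ` J)"

text \<open>\<open>R \<inter> A\<close> for a subset \<open>A\<close> of the fraction field of \<open>R\<close>.\<close>

definition contraction :: "'a::idom fract set \<Rightarrow> 'a set"
  where "contraction A = (\<lambda>r. Fraction_Field.Fract r 1) -` A"

definition symbolic_power :: "'a::idom set \<Rightarrow> nat \<Rightarrow> 'a set"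
  where "symbolic_power I m = contraction (\<Inter>P \<in> Ass I. extension P (ideal_power I m))"

definition Q_below :: "'a::idom set \<Rightarrow> 'a set \<Rightarrow> 'a set"
  where "Q_below I P = contraction (extension P I)"

text \<open>
  \<open>genideal\<close> is an intersection of ideals, hence \<open>UNIV\<close> over a structure that is not a
  ring; the next lemma rules this out for \<open>extension\<close>.
\<close>

lemma cring_localization:
  fixes P :: "'a::idom set"
  assumes "primeideal P type_ring"
  shows "cring (localization P)"
proof -
  interpret primeideal P "type_ring :: 'a ring" by (fact assms)
  have c: "carrier (type_ring :: 'a ring) = UNIV" and [simp]: "\<zero>\<^bsub>(type_ring :: 'a ring)\<^esub> = 0"
    and m: "\<And>a b :: 'a. a \<otimes>\<^bsub>type_ring\<^esub> b = a * b"
    by (simp_all add: ring_of_type_algebra_def)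
  have z: "0 \<in> P" using additive_subgroup.zero_closed[OF is_additive_subgroup] by simp
  have one: "1 \<notin> P"
  proof
    assume "1 \<in> P"
    then have "x \<in> P" for x using I_l_closed[of 1 x] by (simp add: c m)
    then show False using I_notcarr c by blast
  qed
  have mult: "a * b \<notin> P" if "a \<notin> P" "b \<notin> P" for a b
    using I_prime[of a b] that by (auto simp: c m)
  have nz: "s \<noteq> 0" if "s \<notin> P" for s using that z by auto
  let ?L = "{Fraction_Field.Fract a s | a s. s \<notin> P}"
  have zL: "0 \<in> ?L" and oL: "1 \<in> ?L"
    using one by (auto simp: Zero_fract_def One_fract_def)
  have aL: "x + y \<in> ?L" and mL: "x * y \<in> ?L" if "x \<in> ?L" "y \<in> ?L" for x y
  proof -
    obtain a s b t where x: "x = Fraction_Field.Fract a s" "s \<notin> P"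
      and y: "y = Fraction_Field.Fract b t" "t \<notin> P" using \<open>x \<in> ?L\<close> \<open>y \<in> ?L\<close> by blast
    have "x + y = Fraction_Field.Fract (a * t + b * s) (s * t)"
      using x y nz by (simp add: add_fract)
    then show "x + y \<in> ?L" using mult x y by blast
    have "x * y = Fraction_Field.Fract (a * b) (s * t)" using x y by simp
    then show "x * y \<in> ?L" using mult x y by blast
  qed
  have uL: "- x \<in> ?L" if x: "x \<in> ?L" for x
  proof -
    obtain a s where "x = Fraction_Field.Fract a s" "s \<notin> P" using x by blast
    then have "- x = Fraction_Field.Fract (- a) s" by simp
    then show ?thesis using \<open>s \<notin> P\<close> by blast
  qed
  have L: "localization P = \<lparr>carrier = ?L, monoid.mult = (*), one = 1, ring.zero = 0, add = (+)\<rparr>"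
    by (simp add: localization_def ring_of_type_algebra_def)
  show ?thesis
    unfolding L
  proof (rule cringI)
    show "abelian_group \<lparr>carrier = ?L, monoid.mult = (*), one = 1, ring.zero = 0, add = (+)\<rparr>"
    proof (rule abelian_groupI, goal_cases)
      case (6 x)
      then show ?case using uL[of x] by (intro bexI[of _ "- x"]) simp_all
    qed (use aL zL in \<open>simp_all only: partial_object.simps monoid.simps ring.simps ac_simps add_0_left add_0_right\<close>)
    show "comm_monoid \<lparr>carrier = ?L, monoid.mult = (*), one = 1, ring.zero = 0, add = (+)\<rparr>"
      by (rule comm_monoidI)
        (use mL oL in \<open>simp_all only: partial_object.simps monoid.simps ring.simps ac_simps mult_1_left mult_1_right\<close>)
  qed (simp add: distrib_right)
qed

end

theory Submission
  imports Defs
begin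

text \<open>
  The contraction of the extension of \<open>J\<close> at a prime \<open>P\<close> is the saturation
  \<open>{f. \<exists>s. s \<notin> P \<and> s * f \<in> J}\<close>. For a monomial ideal \<open>I\<close> it is
  generated by monomials in the variables \<open>A\<close> that lie in \<open>P\<close>: the other variables become
  units. Powers of such an ideal are again generated by monomials in \<open>A\<close>, and are therefore
  already saturated at \<open>P\<close>; so saturating at \<open>P\<close> commutes with taking powers, for
  every prime \<open>P\<close>. It remains to discard the associated primes that are not maximal. Larger
  primes give smaller saturations, and every associated prime lies in a maximal one because
  there are finitely many: if a term of \<open>g \<in> P = (I : f)\<close> were outside \<open>P\<close>, then
  \<open>g * f \<in> I\<close> would already force \<open>f\<close> into the saturation of \<open>I\<close> at \<open>P\<close>, which is
  absurd; so \<open>P\<close> is monomial, hence determined by the variables it contains.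
\<close>

section \<open>Ideals of the ring of a type\<close>

lemma type_ring_simps [simp]:
  "carrier (type_ring :: 'a::comm_ring_1 ring) = UNIV"
  "\<zero>\<^bsub>(type_ring :: 'a ring)\<^esub> = 0" "\<one>\<^bsub>(type_ring :: 'a ring)\<^esub> = 1"
  "a \<otimes>\<^bsub>(type_ring :: 'a ring)\<^esub> b = a * b" "a \<oplus>\<^bsub>(type_ring :: 'a ring)\<^esub> b = a + b"
  by (simp_all add: ring_of_type_algebra_def)

lemma ideal_type_ring_iff:
  fixes J :: "'a::comm_ring_1 set"
  shows "ideal J type_ring \<longleftrightarrow>
    0 \<in> J \<and> (\<forall>a\<in>J. \<forall>b\<in>J. a + b \<in> J) \<and> (\<forall>a\<in>J. \<forall>r. r * a \<in> J)"
proof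
  assume "ideal J type_ring"
  then interpret ideal J type_ring .
  show "0 \<in> J \<and> (\<forall>a\<in>J. \<forall>b\<in>J. a + b \<in> J) \<and> (\<forall>a\<in>J. \<forall>r. r * a \<in> J)"
    using additive_subgroup.zero_closed[OF is_additive_subgroup]
      additive_subgroup.a_closed[OF is_additive_subgroup] I_l_closed by simp
next
  assume J: "0 \<in> J \<and> (\<forall>a\<in>J. \<forall>b\<in>J. a + b \<in> J) \<and> (\<forall>a\<in>J. \<forall>r. r * a \<in> J)"
  interpret ring "type_ring :: 'a ring" by (rule ring_from_type_algebra)
  have inv: "\<ominus>\<^bsub>type_ring\<^esub> a = - a" for a :: 'a
    by (rule minus_equality) simp_all
  show "ideal J type_ring"
  proof (rule idealI[OF ring_axioms])
    show "subgroup J (add_monoid type_ring)"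
    proof (rule add.subgroupI)
      fix a assume "a \<in> J"
      then have "(- 1) * a \<in> J" using J by blast
      then show "\<ominus>\<^bsub>type_ring\<^esub> a \<in> J" by (simp add: inv)
    qed (use J in auto)
  qed (use J in \<open>auto simp: mult.commute\<close>)
qed

lemma
  assumes "ideal J (type_ring :: 'a::comm_ring_1 ring)"
  shows ideal_zero: "0 \<in> J"
    and ideal_add: "a \<in> J \<Longrightarrow> b \<in> J \<Longrightarrow> a + b \<in> J"
    and ideal_mult: "a \<in> J \<Longrightarrow> r * a \<in> J"
  using assms by (simp_all add: ideal_type_ring_iff)

lemma ideal_sum:
  assumes "ideal J (type_ring :: 'a::comm_ring_1 ring)" and "\<And>x. x \<in> T \<Longrightarrow> f x \<in> J"
  shows "sum f T \<in> J"
  using assms(2) by (induction T rule: infinite_finite_induct)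
    (auto intro: ideal_zero[OF assms(1)] ideal_add[OF assms(1)])

lemma
  assumes "primeideal P (type_ring :: 'a::comm_ring_1 ring)"
  shows prime_ideal: "ideal P type_ring"
    and prime_one: "1 \<notin> P"
    and prime_mult: "a * b \<in> P \<longleftrightarrow> a \<in> P \<or> b \<in> P"
proof -
  interpret primeideal P type_ring by fact
  show P: "ideal P type_ring" by (rule is_ideal)
  show "1 \<notin> P" using ideal_mult[OF P, of 1] I_notcarr by auto
  show "a * b \<in> P \<longleftrightarrow> a \<in> P \<or> b \<in> P"
    using I_prime[of a b] ideal_mult[OF P, of b a] ideal_mult[OF P, of a b]
    by (auto simp: mult.commute)
qed

lemma ideal_power_0 [simp]: "ideal_power I 0 = UNIV"
  by (simp add: ideal_power_def nat_pow_def ideals_set_def)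

lemma ideal_power_Suc [simp]:
  "ideal_power I (Suc m) = ideal_prod type_ring (ideal_power I m) I"
  by (simp add: ideal_power_def nat_pow_def ideals_set_def)

lemma ideal_ideal_prod:
  fixes I J :: "'a::comm_ring_1 set"
  assumes "ideal I type_ring" "ideal J type_ring"
  shows "ideal (ideal_prod type_ring I J) type_ring"
  using ring.ideal_prod_is_ideal[OF ring_from_type_algebra assms] .

lemma ideal_ideal_power:
  assumes "ideal I (type_ring :: 'a::comm_ring_1 ring)"
  shows "ideal (ideal_power I m) type_ring"
  by (induction m) (auto simp: ideal_type_ring_iff[of UNIV] intro: ideal_ideal_prod assms)

lemma ideal_prod_mono:
  assumes "I \<subseteq> I'" "J \<subseteq> J'"
  shows "ideal_prod R I J \<subseteq> ideal_prod R I' J'"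
proof
  show "x \<in> ideal_prod R I' J'" if "x \<in> ideal_prod R I J" for x
    using that by induction (use assms in \<open>auto intro: ideal_prod.intros\<close>)
qed

lemma ideal_power_mono: "I \<subseteq> J \<Longrightarrow> ideal_power I m \<subseteq> ideal_power J m"
  by (induction m) (auto intro: ideal_prod_mono[THEN subsetD])

section \<open>Saturation at a prime ideal\<close>

definition sat :: "'a::comm_ring_1 set \<Rightarrow> 'a set \<Rightarrow> 'a set"
  where "sat P J = {f. \<exists>s. s \<notin> P \<and> s * f \<in> J}"

lemma sat_antimono: "P \<subseteq> P' \<Longrightarrow> sat P' J \<subseteq> sat P J"
  by (auto simp: sat_def)

lemma subset_sat:
  assumes "primeideal P type_ring"
  shows "J \<subseteq> sat P J"
  unfolding sat_def using prime_one[OF assms] by (force intro: exI[of _ 1])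

lemma ideal_sat:
  assumes P: "primeideal P (type_ring :: 'a::comm_ring_1 ring)" and J: "ideal J type_ring"
  shows "ideal (sat P J) type_ring"
  unfolding ideal_type_ring_iff
proof (intro conjI ballI allI)
  show "0 \<in> sat P J" using subset_sat[OF P] ideal_zero[OF J] by blast
next
  fix a b assume "a \<in> sat P J" "b \<in> sat P J"
  then obtain s t where s: "s \<notin> P" "s * a \<in> J" and t: "t \<notin> P" "t * b \<in> J"
    by (auto simp: sat_def)
  from ideal_add[OF J ideal_mult[OF J s(2), of t] ideal_mult[OF J t(2), of s]]
  have "(s * t) * (a + b) \<in> J" by (simp add: algebra_simps)
  then show "a + b \<in> sat P J" using s t prime_mult[OF P] unfolding sat_def by blast
next
  fix a r assume "a \<in> sat P J"
  then obtain s where "s \<notin> P" "s * a \<in> J" by (auto simp: sat_def)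
  then show "r * a \<in> sat P J"
    unfolding sat_def using ideal_mult[OF J, of "s * a" r] by (auto simp: mult.left_commute)
qed

text \<open>If \<open>s\<close> clears \<open>a\<close> and \<open>t\<close> clears
  \<open>b\<close>, then \<open>s * t\<close> clears \<open>a * b\<close>, and primality keeps
  \<open>s * t\<close> outside \<open>P\<close>. This easy inclusion does not depend on
  monomials.\<close>

lemma ideal_prod_sat_subset:
  assumes P: "primeideal P (type_ring :: 'a::comm_ring_1 ring)"
    and I: "ideal I type_ring" and J: "ideal J type_ring"
  shows "ideal_prod type_ring (sat P I) (sat P J) \<subseteq> sat P (ideal_prod type_ring I J)"
proof
  show "x \<in> sat P (ideal_prod type_ring I J)"
    if "x \<in> ideal_prod type_ring (sat P I) (sat P J)" for x
    using that
  proof induction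
    case (prod a b)
    then obtain s t where s: "s \<notin> P" "s * a \<in> I" and t: "t \<notin> P" "t * b \<in> J"
      by (auto simp: sat_def)
    have "(s * t) * (a * b) \<in> ideal_prod type_ring I J"
      using ideal_prod.prod[OF s(2) t(2), of type_ring] by (simp add: algebra_simps)
    then show ?case using s t prime_mult[OF P] unfolding sat_def by auto
  next
    case (sum a b)
    then show ?case using ideal_add[OF ideal_sat[OF P ideal_ideal_prod[OF I J]]] by simp
  qed
qed

lemma ideal_power_sat_subset:
  assumes P: "primeideal P (type_ring :: 'a::comm_ring_1 ring)" and I: "ideal I type_ring"
  shows "ideal_power (sat P I) m \<subseteq> sat P (ideal_power I m)"
proof (induction m)
  case 0
  show ?case using subset_sat[OF P, of UNIV] by simp
next
  case (Suc m)
  show ?case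
    using ideal_prod_mono[OF Suc order_refl] ideal_prod_sat_subset[OF P ideal_ideal_power[OF I] I]
    by fastforce
qed

text \<open>Eliminates fractions: from here on, every localization is handled through
  \<open>sat\<close>, inside the polynomial ring.\<close>

lemma contraction_extension:
  fixes P :: "'a::idom set"
  assumes P: "primeideal P type_ring" and J: "ideal J type_ring"
  shows "contraction (extension P J) = sat P J"
proof
  let ?L = "localization P"
  interpret L: cring ?L by (rule cring_localization[OF P])
  have Ps: "s \<noteq> 0" if "s \<notin> P" for s using that ideal_zero[OF prime_ideal[OF P]] by auto
  have cL: "carrier ?L = {Fraction_Field.Fract a s | a s. s \<notin> P}"
    and oL: "\<And>x y. x \<otimes>\<^bsub>?L\<^esub> y = x * y" and aL: "\<And>x y. x \<oplus>\<^bsub>?L\<^esub> y = x + y"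
    by (simp_all add: localization_def ring_of_type_algebra_def)
  have sub: "(\<lambda>r. Fraction_Field.Fract r 1) ` J \<subseteq> carrier ?L"
    using prime_one[OF P] by (auto simp: cL)
  have E: "ideal (extension P J) ?L"
    unfolding extension_def by (rule L.genideal_ideal[OF sub])
  show "sat P J \<subseteq> contraction (extension P J)"
  proof
    fix r assume "r \<in> sat P J"
    then obtain s where s: "s \<notin> P" "s * r \<in> J" by (auto simp: sat_def)
    have "Fraction_Field.Fract (s * r) 1 \<in> extension P J"
      using L.genideal_self[OF sub] s unfolding extension_def by auto
    moreover have "Fraction_Field.Fract 1 s \<in> carrier ?L" using s by (auto simp: cL)
    ultimately have "Fraction_Field.Fract 1 s * Fraction_Field.Fract (s * r) 1 \<in> extension P J"
      using ideal.I_l_closed[OF E] unfolding oL by blast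
    moreover have "Fraction_Field.Fract 1 s * Fraction_Field.Fract (s * r) 1 = Fraction_Field.Fract r 1"
      using Ps[OF s(1)] by (simp add: eq_fract)
    ultimately show "r \<in> contraction (extension P J)" by (simp add: contraction_def)
  qed
  \<comment> \<open>The extension of \<open>J\<close> consists of fractions with numerator in
    \<open>J\<close>. Only one inclusion is needed: \<open>F\<close> is an ideal containing the
    image of \<open>J\<close>, so it contains the generated ideal.\<close>
  define F where "F = {Fraction_Field.Fract a s | a s. a \<in> J \<and> s \<notin> P}"
  have FI: "Fraction_Field.Fract a s \<in> F" if "a \<in> J" "s \<notin> P" for a s
    using that by (auto simp: F_def)
  have FL: "x * y \<in> F" if y: "y \<in> F" and x: "x \<in> carrier ?L" for x y
  proof -
    obtain a s b t where "y = Fraction_Field.Fract a s" "a \<in> J" "s \<notin> P"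
      "x = Fraction_Field.Fract b t" "t \<notin> P" using x y by (auto simp: cL F_def)
    then show ?thesis using ideal_mult[OF J] prime_mult[OF P] by (auto intro!: FI)
  qed
  have F: "ideal F ?L"
  proof (rule idealI[OF L.ring_axioms])
    show "subgroup F (add_monoid ?L)"
    proof (rule L.add.subgroupI)
      show "F \<subseteq> carrier ?L" by (auto simp: F_def cL)
      show "F \<noteq> {}" using FI[OF ideal_zero[OF J] prime_one[OF P]] by blast
    next
      fix x assume x: "x \<in> F"
      then have xc: "x \<in> carrier ?L" by (auto simp: F_def cL)
      \<comment> \<open>Negation is multiplication by minus one, so closure under it follows from
        \<open>FL\<close>.\<close>
      have "\<ominus>\<^bsub>?L\<^esub> x = (\<ominus>\<^bsub>?L\<^esub> \<one>\<^bsub>?L\<^esub>) * x"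
        using L.l_minus[OF L.one_closed xc] L.l_one[OF xc] unfolding oL by simp
      then show "\<ominus>\<^bsub>?L\<^esub> x \<in> F" using FL[OF x] by simp
    next
      fix x y assume "x \<in> F" "y \<in> F"
      then obtain a s b t where x: "x = Fraction_Field.Fract a s" "a \<in> J" "s \<notin> P"
        and y: "y = Fraction_Field.Fract b t" "b \<in> J" "t \<notin> P" by (auto simp: F_def)
      have "t * a + s * b \<in> J" using x y by (intro ideal_add[OF J] ideal_mult[OF J])
      then have "Fraction_Field.Fract (t * a + s * b) (s * t) \<in> F"
        using x y prime_mult[OF P] by (intro FI) auto
      then show "x \<oplus>\<^bsub>?L\<^esub> y \<in> F" using x y Ps by (simp add: aL mult.commute)
    qed
  qed (use FL in \<open>simp_all add: oL mult.commute\<close>)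
  have "extension P J \<subseteq> F"
    unfolding extension_def
    by (rule L.genideal_minimal[OF F]) (use prime_one[OF P] in \<open>auto intro: FI\<close>)
  then show "contraction (extension P J) \<subseteq> sat P J"
  proof (intro subsetI)
    fix r assume "extension P J \<subseteq> F" "r \<in> contraction (extension P J)"
    then obtain a s where "Fraction_Field.Fract r 1 = Fraction_Field.Fract a s" "a \<in> J" "s \<notin> P"
      by (auto simp: contraction_def F_def)
    then have "s * r \<in> J" using Ps by (simp add: eq_fract mult.commute)
    then show "r \<in> sat P J" using \<open>s \<notin> P\<close> by (auto simp: sat_def)
  qed
qed

section \<open>Monomials and restriction\<close>

abbreviation mon :: "('v \<Rightarrow>\<^sub>0 nat) \<Rightarrow> ('v, 'k::field) mpoly"
  where "mon e \<equiv> Poly_Mapping.single e 1"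

abbreviation var :: "'v \<Rightarrow> ('v, 'k::field) mpoly"
  where "var v \<equiv> mon (Poly_Mapping.single v 1)"

lemma mon_add: "mon (a + b) = mon a * mon b"
  by (simp add: mult_single)

lemma poly_eq_sum_mon:
  fixes f :: "('v, 'k::field) mpoly"
  shows "f = (\<Sum>e\<in>Poly_Mapping.keys f. Poly_Mapping.single 0 (Poly_Mapping.lookup f e) * mon e)"
proof (rule poly_mapping_eqI)
  fix k
  show "Poly_Mapping.lookup f k = Poly_Mapping.lookup
    (\<Sum>e\<in>Poly_Mapping.keys f. Poly_Mapping.single 0 (Poly_Mapping.lookup f e) * mon e) k"
    by (simp add: lookup_sum mult_single lookup_single when_def sum.delta' in_keys_iff)
qed

lemma ideal_mons:
  fixes f :: "('v, 'k::field) mpoly"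
  assumes "ideal J type_ring" "\<And>e. e \<in> Poly_Mapping.keys f \<Longrightarrow> mon e \<in> J"
  shows "f \<in> J"
  by (subst poly_eq_sum_mon) (intro ideal_sum ideal_mult assms)

text \<open>Serves two purposes: on an exponent vector it keeps the variables in \<open>A\<close>;
  on a polynomial it keeps the terms whose exponent vectors lie in \<open>A\<close>.\<close>

definition restr :: "'a set \<Rightarrow> ('a \<Rightarrow>\<^sub>0 'b::zero) \<Rightarrow> 'a \<Rightarrow>\<^sub>0 'b"
  where "restr A p = Poly_Mapping.mapp (\<lambda>k c. c when k \<in> A) p"

lemma lookup_restr: "Poly_Mapping.lookup (restr A p) k = (if k \<in> A then Poly_Mapping.lookup p k else 0)"
  by (auto simp: restr_def lookup_mapp when_def in_keys_iff)

lemma keys_restr: "Poly_Mapping.keys (restr A p) = Poly_Mapping.keys p \<inter> A"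
  by (auto simp: in_keys_iff lookup_restr split: if_splits)

lemma restr_add: "restr A (p + q) = restr A p + restr A (q :: 'a \<Rightarrow>\<^sub>0 'b::monoid_add)"
  by (rule poly_mapping_eqI) (simp add: lookup_restr lookup_add)

lemma restr_restr [simp]: "restr A (restr A p) = restr A p"
  by (rule poly_mapping_eqI) (simp add: lookup_restr)

lemma restr_UNIV [simp]: "restr UNIV p = p"
  by (rule poly_mapping_eqI) (simp add: lookup_restr)

lemma restr_compl: "restr A p + restr (- A) p = (p :: 'a \<Rightarrow>\<^sub>0 'b::monoid_add)"
  by (rule poly_mapping_eqI) (simp add: lookup_restr lookup_add)

lemma keys_mult_E:
  assumes "e \<in> Poly_Mapping.keys (p * q)"
  obtains a b where "a \<in> Poly_Mapping.keys p" "b \<in> Poly_Mapping.keys q" "e = a + b"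
  using keys_mult[of p q] assms by blast

section \<open>Ideals generated by monomials in a set of variables\<close>

text \<open>Expresses generation by monomials in the variables \<open>A\<close> without naming
  generators: each term of \<open>f\<close> is a multiple of its \<open>A\<close>-part. This form
  passes easily to products.\<close>

definition mono_ideal :: "'v set \<Rightarrow> ('v, 'k::field) mpoly set \<Rightarrow> bool"
  where "mono_ideal A J \<longleftrightarrow>
    ideal J type_ring \<and> (\<forall>f\<in>J. \<forall>e\<in>Poly_Mapping.keys f. mon (restr A e) \<in> J)"

lemma monomial_ideal_imp_mono_ideal:
  fixes I :: "('v, 'k::field) mpoly set"
  assumes "monomial_ideal I"
  shows "mono_ideal UNIV I"
proof -
  interpret ring "type_ring :: ('v, 'k) mpoly ring" by (rule ring_from_type_algebra)
  obtain E where I: "I = genideal type_ring (mon ` E)"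
    using assms by (auto simp: monomial_ideal_def)
  have idI: "ideal I type_ring" unfolding I by (rule genideal_ideal) simp
  \<comment> \<open>It suffices that \<open>?J\<close> is an ideal containing the generators, since
    \<open>I\<close> is the least such ideal.\<close>
  let ?J = "{f :: ('v, 'k) mpoly. \<forall>e\<in>Poly_Mapping.keys f. mon e \<in> I}"
  have "ideal ?J type_ring"
    unfolding ideal_type_ring_iff
  proof (intro conjI ballI allI)
    fix a b assume "a \<in> ?J" "b \<in> ?J"
    then show "a + b \<in> ?J" using keys_add[of a b] by blast
  next
    fix a r assume "a \<in> ?J"
    then show "r * a \<in> ?J"
      by (fastforce elim!: keys_mult_E simp: mon_add intro: ideal_mult[OF idI])
  qed simp
  moreover have "mon ` E \<subseteq> ?J"
    unfolding I using genideal_self[of "mon ` E"] by auto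
  ultimately have "I \<subseteq> ?J" unfolding I by (rule genideal_minimal)
  then show ?thesis using idI by (auto simp: mono_ideal_def)
qed

lemma mono_ideal_prod:
  assumes I: "mono_ideal A I" and J: "mono_ideal A (J :: ('v, 'k::field) mpoly set)"
  shows "mono_ideal A (ideal_prod type_ring I J)"
  unfolding mono_ideal_def
proof (intro conjI ballI)
  show id: "ideal (ideal_prod type_ring I J) type_ring"
    using I J by (auto simp: mono_ideal_def intro: ideal_ideal_prod)
  show "mon (restr A e) \<in> ideal_prod type_ring I J"
    if "f \<in> ideal_prod type_ring I J" "e \<in> Poly_Mapping.keys f" for f e
    using that
  proof (induction arbitrary: e)
    case (prod i j)
    then obtain a b where ab: "a \<in> Poly_Mapping.keys i" "b \<in> Poly_Mapping.keys j" "e = a + b"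
      by (auto elim: keys_mult_E)
    have "mon (restr A a) \<in> I" "mon (restr A b) \<in> J"
      using prod ab I J by (auto simp: mono_ideal_def)
    from ideal_prod.prod[OF this, of type_ring] show ?case
      by (simp add: ab restr_add mon_add)
  next
    case (sum f g)
    then show ?case using keys_add[of f g] by auto
  qed
qed

lemma mono_ideal_power:
  assumes "mono_ideal A (I :: ('v, 'k::field) mpoly set)"
  shows "mono_ideal A (ideal_power I m)"
proof (induction m)
  case 0
  show ?case by (simp add: mono_ideal_def ideal_type_ring_iff)
qed (simp add: mono_ideal_prod assms)

text \<open>
  Grade by the \<open>A\<close>-part of exponents. For a term of \<open>f\<close> outside \<open>J\<close> with
  \<open>A\<close>-part \<open>a\<close> of least degree, the component of \<open>s * f\<close> in degree \<open>a\<close> can only arise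
  from the components \<open>s0\<close> of \<open>s\<close> in degree \<open>0\<close> and \<open>fa\<close> of \<open>f\<close> in degree \<open>a\<close>, up to
  terms that would force the monomial of \<open>a\<close> into \<open>J\<close>.
\<close>

lemma mono_ideal_cancel:
  fixes J :: "('v::{finite,linorder}, 'k::field) mpoly set"
  assumes J: "mono_ideal A J" and sf: "s * f \<in> J"
    and c0: "c0 \<in> Poly_Mapping.keys s" "restr A c0 = 0"
  shows "f \<in> J"
proof -
  have idJ: "ideal J type_ring" using J by (simp add: mono_ideal_def)
  define deg :: "('v \<Rightarrow>\<^sub>0 nat) \<Rightarrow> nat" where "deg e = (\<Sum>v\<in>UNIV. Poly_Mapping.lookup e v)" for e
  have deg_add: "deg (a + b) = deg a + deg b" for a b
    by (simp add: deg_def lookup_add sum.distrib)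
  have deg_0: "deg a = 0 \<Longrightarrow> a = 0" for a
    by (auto simp: deg_def intro: poly_mapping_eqI)
  have "mon (restr A e) \<in> J" if e: "e \<in> Poly_Mapping.keys f" for e
  proof (rule ccontr)
    let ?bad = "\<lambda>e. e \<in> Poly_Mapping.keys f \<and> mon (restr A e) \<notin> J"
    assume "mon (restr A e) \<notin> J"
    then obtain e1 where e1: "?bad e1"
      and least: "\<And>b. ?bad b \<Longrightarrow> deg (restr A e1) \<le> deg (restr A b)"
      using e ex_has_least_nat[of ?bad e "\<lambda>e. deg (restr A e)"] by blast
    define a where "a = restr A e1"
    define s0 where "s0 = restr {c. restr A c = 0} s"
    define fa where "fa = restr {b. restr A b = a} f"
    have "s0 \<noteq> 0" "fa \<noteq> 0"
      using c0 e1 by (auto simp: s0_def fa_def a_def keys_restr simp flip: keys_eq_empty)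
    \<comment> \<open>The polynomial ring is a domain, so the product of these two nonzero
      components has a term \<open>k\<close>. The rest shows that \<open>k\<close> is not cancelled
      in \<open>s * f\<close>.\<close>
    then have "s0 * fa \<noteq> 0" by simp
    then obtain k where k: "k \<in> Poly_Mapping.keys (s0 * fa)"
      using keys_eq_empty by blast
    then have ka: "restr A k = a"
      by (auto elim!: keys_mult_E simp: s0_def fa_def keys_restr restr_add)
    have s: "s = s0 + restr (- {c. restr A c = 0}) s" (is "s = s0 + ?s1")
      by (simp add: s0_def restr_compl)
    have f: "f = fa + restr (- {b. restr A b = a}) f" (is "f = fa + ?g")
      by (simp add: fa_def restr_compl)
    have "k \<notin> Poly_Mapping.keys (?s1 * f)"
    proof
      assume "k \<in> Poly_Mapping.keys (?s1 * f)"
      then obtain c b where c: "restr A c \<noteq> 0" and b: "b \<in> Poly_Mapping.keys f" and "k = c + b"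
        by (auto elim!: keys_mult_E simp: keys_restr)
      then have a: "a = restr A c + restr A b" using ka by (simp add: restr_add)
      \<comment> \<open>The monomial of \<open>a\<close> is a multiple of that of
        \<open>restr A b\<close>, so \<open>b\<close> is bad too. Its degree would be strictly
        smaller, because \<open>restr A c\<close> is nonzero.\<close>
      have "mon (restr A b) \<notin> J"
        using e1 ideal_mult[OF idJ] by (auto simp: a_def[symmetric] a mon_add)
      with b have "deg a \<le> deg (restr A b)" using least by (simp add: a_def)
      then show False using c deg_0[of "restr A c"] by (simp add: a deg_add)
    qed
    moreover have "k \<notin> Poly_Mapping.keys (s0 * ?g)"
      using ka by (auto elim!: keys_mult_E simp: s0_def keys_restr restr_add)
    moreover have "s * f = s0 * (fa + ?g) + ?s1 * f"
      by (simp only: s[symmetric] f[symmetric] distrib_right[symmetric])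
    ultimately have "k \<in> Poly_Mapping.keys (s * f)"
      using k by (simp add: in_keys_iff lookup_add distrib_left)
    then have "mon a \<in> J" using J sf ka by (auto simp: mono_ideal_def)
    then show False using e1 by (simp add: a_def)
  qed
  then have "mon e \<in> J" if "e \<in> Poly_Mapping.keys f" for e
    using that ideal_mult[OF idJ, of "mon (restr A e)" "mon (restr (- A) e)"]
    by (simp add: restr_compl add.commute flip: mon_add)
  then show ?thesis by (rule ideal_mons[OF idJ])
qed

section \<open>Saturations of monomial ideals\<close>

text \<open>By primality a product of variables lies in \<open>P\<close> exactly when one of its
  factors does. The induction on total degree splits off one variable at a time.\<close>

lemma prime_mon_iff:
  fixes P :: "('v, 'k::field) mpoly set"
  assumes P: "primeideal P type_ring"
  shows "mon e \<in> P \<longleftrightarrow> restr {v. var v \<in> P} e \<noteq> 0"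
proof -
  have *: "mon e \<in> P \<longleftrightarrow> (\<exists>v\<in>Poly_Mapping.keys e. var v \<in> P)"
  proof (induction "\<Sum>v\<in>Poly_Mapping.keys e. Poly_Mapping.lookup e v" arbitrary: e rule: less_induct)
    case less
    show ?case
    proof (cases "e = 0")
      case True
      then show ?thesis using prime_one[OF P] by simp
    next
      case False
      then obtain v where v: "v \<in> Poly_Mapping.keys e" using keys_eq_empty by blast
      \<comment> \<open>Subtraction of exponents is truncated, but exact here because
        \<open>v\<close> occurs in \<open>e\<close>.\<close>
      define d where "d = e - Poly_Mapping.single v 1"
      have e: "e = Poly_Mapping.single v 1 + d"
        using v by (intro poly_mapping_eqI)
          (auto simp: d_def lookup_add lookup_minus lookup_single when_def in_keys_iff)
      have kd: "Poly_Mapping.keys d \<subseteq> Poly_Mapping.keys e"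
        by (auto simp: e in_keys_iff lookup_add)
      have ke: "Poly_Mapping.keys e = insert v (Poly_Mapping.keys d)"
        by (auto simp: e in_keys_iff lookup_add lookup_single when_def split: if_splits)
      have "(\<Sum>u\<in>Poly_Mapping.keys d. Poly_Mapping.lookup d u)
          = (\<Sum>u\<in>Poly_Mapping.keys e. Poly_Mapping.lookup d u)"
        using kd by (intro sum.mono_neutral_left) (auto simp: in_keys_iff)
      also have "\<dots> < (\<Sum>u\<in>Poly_Mapping.keys e. Poly_Mapping.lookup e u)"
        using v by (intro sum_strict_mono_ex1) (auto simp: e lookup_add intro!: bexI[of _ v])
      finally have "mon d \<in> P \<longleftrightarrow> (\<exists>v\<in>Poly_Mapping.keys d. var v \<in> P)"
        by (rule less)
      moreover have "mon e \<in> P \<longleftrightarrow> var v \<in> P \<or> mon d \<in> P"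
        using prime_mult[OF P] by (simp add: e mon_add)
      ultimately show ?thesis by (auto simp: ke)
    qed
  qed
  show ?thesis
    unfolding * by (simp add: keys_restr disjoint_iff Bex_def flip: keys_eq_empty)
qed

text \<open>A candidate for \<open>sat P I\<close> that is generated by monomials in the variables
  of \<open>P\<close> by construction, so that cancellation applies to it before the two are known
  to agree.\<close>

definition sat_terms :: "('v, 'k::field) mpoly set \<Rightarrow> ('v, 'k) mpoly set \<Rightarrow> ('v, 'k) mpoly set"
  where "sat_terms P I =
    {f. \<forall>e\<in>Poly_Mapping.keys f. mon (restr {v. var v \<in> P} e) \<in> sat P I}"

lemma mono_ideal_sat_terms:
  fixes I :: "('v, 'k::field) mpoly set"
  assumes P: "primeideal P type_ring" and I: "ideal I type_ring"
  shows "mono_ideal {v. var v \<in> P} (sat_terms P I)"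
proof -
  note S = ideal_sat[OF P I]
  have "ideal (sat_terms P I) type_ring"
    unfolding ideal_type_ring_iff
  proof (intro conjI ballI allI)
    fix a b assume "a \<in> sat_terms P I" "b \<in> sat_terms P I"
    then show "a + b \<in> sat_terms P I" using keys_add[of a b] by (auto simp: sat_terms_def)
  next
    fix a r assume "a \<in> sat_terms P I"
    then show "r * a \<in> sat_terms P I"
      by (fastforce simp: sat_terms_def restr_add mon_add elim!: keys_mult_E intro: ideal_mult[OF S])
  qed (simp add: sat_terms_def)
  then show ?thesis by (auto simp: mono_ideal_def sat_terms_def)
qed

lemma sat_terms_subset_sat:
  fixes I :: "('v, 'k::field) mpoly set"
  assumes P: "primeideal P type_ring" and I: "ideal I type_ring"
  shows "sat_terms P I \<subseteq> sat P I"
proof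
  fix f assume f: "f \<in> sat_terms P I"
  note S = ideal_sat[OF P I]
  show "f \<in> sat P I"
  proof (rule ideal_mons[OF S])
    fix e assume "e \<in> Poly_Mapping.keys f"
    with f have "mon (restr (- {v. var v \<in> P}) e) * mon (restr {v. var v \<in> P} e) \<in> sat P I"
      by (auto simp: sat_terms_def intro: ideal_mult[OF S])
    then show "mon e \<in> sat P I" by (simp add: restr_compl add.commute flip: mon_add)
  qed
qed

lemma subset_sat_terms:
  fixes I :: "('v, 'k::field) mpoly set"
  assumes P: "primeideal P type_ring" and I: "mono_ideal UNIV I"
  shows "I \<subseteq> sat_terms P I"
proof
  let ?A = "{v. var v \<in> P}"
  fix f assume "f \<in> I"
  show "f \<in> sat_terms P I"
    unfolding sat_terms_def
  proof (intro CollectI ballI)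
    fix e assume "e \<in> Poly_Mapping.keys f"
    then have "mon e \<in> I" using I \<open>f \<in> I\<close> by (auto simp: mono_ideal_def)
    \<comment> \<open>The cofactor of the \<open>?A\<close>-part involves no variable of
      \<open>P\<close>; it is therefore outside \<open>P\<close> and serves as denominator.\<close>
    then have "mon (restr (- ?A) e) * mon (restr ?A e) \<in> I"
      by (simp add: restr_compl add.commute flip: mon_add)
    moreover have "restr ?A (restr (- ?A) e) = 0"
      by (rule poly_mapping_eqI) (simp add: lookup_restr)
    then have "mon (restr (- ?A) e) \<notin> P" by (simp only: prime_mon_iff[OF P, of "restr (- ?A) e"] not_not)
    ultimately show "mon (restr ?A e) \<in> sat P I" unfolding sat_def by blast
  qed
qed

text \<open>Cancellation needs just one term of \<open>s\<close> outside \<open>P\<close>. The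
  polynomial \<open>s\<close> itself may lie in \<open>P\<close>, which is the case arising in
  \<open>Ass_mon\<close>.\<close>

lemma sat_termsI:
  fixes I :: "('v::{finite,linorder}, 'k::field) mpoly set"
  assumes P: "primeideal P type_ring" and I: "mono_ideal UNIV I"
    and "s * f \<in> I" "c \<in> Poly_Mapping.keys s" "mon c \<notin> P"
  shows "f \<in> sat_terms P I"
proof (rule mono_ideal_cancel)
  show "mono_ideal {v. var v \<in> P} (sat_terms P I)"
    using I by (intro mono_ideal_sat_terms[OF P]) (simp add: mono_ideal_def)
  show "s * f \<in> sat_terms P I" using assms subset_sat_terms[OF P I] by blast
  show "restr {v. var v \<in> P} c = 0" using assms prime_mon_iff[OF P, of c] by blast
qed fact

lemma obtain_mon_notin:
  assumes "ideal P type_ring" "s \<notin> (P :: ('v, 'k::field) mpoly set)"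
  obtains c where "c \<in> Poly_Mapping.keys s" "mon c \<notin> P"
  using ideal_mons[OF assms(1)] assms(2) by blast

lemma mono_ideal_sat:
  fixes I :: "('v::{finite,linorder}, 'k::field) mpoly set"
  assumes P: "primeideal P type_ring" and I: "mono_ideal UNIV I"
  shows "mono_ideal {v. var v \<in> P} (sat P I)"
proof -
  have idI: "ideal I type_ring" using I by (simp add: mono_ideal_def)
  have "sat P I \<subseteq> sat_terms P I"
  proof
    fix f assume "f \<in> sat P I"
    then obtain s where "s \<notin> P" "s * f \<in> I" by (auto simp: sat_def)
    then show "f \<in> sat_terms P I"
      by (meson obtain_mon_notin[OF prime_ideal[OF P]] sat_termsI[OF P I])
  qed
  then have "sat P I = sat_terms P I" using sat_terms_subset_sat[OF P idI] by blast
  then show ?thesis using mono_ideal_sat_terms[OF P idI] by simp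
qed

lemma sat_ideal_power:
  fixes I :: "('v::{finite,linorder}, 'k::field) mpoly set"
  assumes P: "primeideal P type_ring" and I: "mono_ideal UNIV I"
  shows "sat P (ideal_power I m) = ideal_power (sat P I) m"
proof
  show "ideal_power (sat P I) m \<subseteq> sat P (ideal_power I m)"
    using I by (intro ideal_power_sat_subset[OF P]) (simp add: mono_ideal_def)
  show "sat P (ideal_power I m) \<subseteq> ideal_power (sat P I) m"
  proof
    fix f assume "f \<in> sat P (ideal_power I m)"
    then obtain s where s: "s \<notin> P" "s * f \<in> ideal_power I m" by (auto simp: sat_def)
    obtain c where c: "c \<in> Poly_Mapping.keys s" "mon c \<notin> P"
      using obtain_mon_notin[OF prime_ideal[OF P] s(1)] .
    show "f \<in> ideal_power (sat P I) m"
    \<comment> \<open>The target power contains \<open>ideal_power I m\<close> and is generated by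
      monomials in the variables of \<open>P\<close>, so the factor \<open>s\<close> cancels inside
      it.\<close>
    proof (rule mono_ideal_cancel)
      show "mono_ideal {v. var v \<in> P} (ideal_power (sat P I) m)"
        by (intro mono_ideal_power mono_ideal_sat P I)
      show "s * f \<in> ideal_power (sat P I) m"
        using s(2) ideal_power_mono[OF subset_sat[OF P]] by blast
      show "restr {v. var v \<in> P} c = 0" using c prime_mon_iff[OF P, of c] by blast
    qed fact
  qed
qed

section \<open>Associated primes of monomial ideals\<close>

lemma Ass_mon:
  fixes I :: "('v::{finite,linorder}, 'k::field) mpoly set"
  assumes I: "mono_ideal UNIV I" and PA: "P \<in> Ass I" and "g \<in> P" "c \<in> Poly_Mapping.keys g"
  shows "mon c \<in> P"
proof (rule ccontr)
  assume c: "mon c \<notin> P"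
  obtain f where P: "primeideal P type_ring" and f: "P = {r. r * f \<in> I}"
    using PA by (auto simp: Ass_def)
  have "f \<in> sat_terms P I"
    using assms(3,4) c by (intro sat_termsI[OF P I, of g]) (auto simp: f)
  then have "f \<in> sat P I"
    using sat_terms_subset_sat[OF P] I by (auto simp: mono_ideal_def)
  \<comment> \<open>A denominator \<open>s\<close> outside \<open>P\<close> with
    \<open>s * f\<close> in \<open>I\<close> would belong to the colon ideal, which is
    \<open>P\<close>.\<close>
  then show False by (auto simp: sat_def f)
qed

lemma finite_Ass:
  fixes I :: "('v::{finite,linorder}, 'k::field) mpoly set"
  assumes I: "mono_ideal UNIV I"
  shows "finite (Ass I)"
proof (rule finite_imageD)
  \<comment> \<open>There are finitely many variables, hence finitely many sets of them.\<close>
  show "finite ((\<lambda>P. {v. var v \<in> P}) ` Ass I)" by simp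
  have "P \<subseteq> Q" if P: "P \<in> Ass I" and Q: "Q \<in> Ass I" and v: "{v. var v \<in> P} = {v. var v \<in> Q}"
    for P Q
  proof
    have prP: "primeideal P type_ring" and prQ: "primeideal Q type_ring"
      using P Q by (auto simp: Ass_def)
    show "g \<in> Q" if "g \<in> P" for g
    proof (rule ideal_mons[OF prime_ideal[OF prQ]])
      fix e assume "e \<in> Poly_Mapping.keys g"
      then have "mon e \<in> P" by (rule Ass_mon[OF I P that])
      then show "mon e \<in> Q" by (simp only: prime_mon_iff[OF prP, of e] prime_mon_iff[OF prQ, of e] v not_False_eq_True)
    qed
  qed
  then show "inj_on (\<lambda>P. {v. var v \<in> P}) (Ass I)" by (intro inj_onI equalityI) simp_all
qed

theorem theorem3p7:
  fixes I :: "('v::{finite,linorder}, 'k::field) mpoly set" and m :: nat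
  assumes "monomial_ideal I" and "m > 0"
  shows "symbolic_power I m = (\<Inter>P \<in> maxAss I. ideal_power (Q_below I P) m)"
proof -
  have I: "mono_ideal UNIV I" by (rule monomial_ideal_imp_mono_ideal) fact
  then have idI: "ideal I type_ring" by (simp add: mono_ideal_def)
  have pr: "primeideal P type_ring" if "P \<in> Ass I" for P using that by (simp add: Ass_def)
  \<comment> \<open>Contraction is a preimage and commutes with intersections. If \<open>I\<close>
    is the whole ring, \<open>Ass I\<close> is empty and both sides are \<open>UNIV\<close>.\<close>
  have "symbolic_power I m = (\<Inter>P\<in>Ass I. contraction (extension P (ideal_power I m)))"
    by (simp add: symbolic_power_def contraction_def vimage_INT)
  also have "\<dots> = (\<Inter>P\<in>Ass I. sat P (ideal_power I m))"
    using pr by (simp add: contraction_extension ideal_ideal_power[OF idI])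
  also have "\<dots> = (\<Inter>P\<in>maxAss I. sat P (ideal_power I m))"
  \<comment> \<open>Each member of either family must contain a member of the other; for
    \<open>P\<close> in \<open>Ass I\<close>, a maximal \<open>P'\<close> above \<open>P\<close>
    provides it.\<close>
  proof (rule INF_eq)
    fix P assume "P \<in> Ass I"
    then obtain P' where "P' \<in> Ass I" "P \<subseteq> P'" "\<forall>P''\<in>Ass I. P' \<subseteq> P'' \<longrightarrow> P' = P''"
      using finite_has_maximal2[OF finite_Ass[OF I]] by metis
    then show "\<exists>P'\<in>maxAss I. sat P' (ideal_power I m) \<subseteq> sat P (ideal_power I m)"
      by (intro bexI[of _ P'] sat_antimono) (auto simp: maxAss_def)
  qed (auto simp: maxAss_def)
  also have "\<dots> = (\<Inter>P\<in>maxAss I. ideal_power (Q_below I P) m)"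
    using pr by (simp add: maxAss_def sat_ideal_power[OF _ I] Q_below_def contraction_extension idI)
  finally show ?thesis .
qed

end
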